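(* Consider the one-dimensional scattering problem $\psi''+k^2\psi=0$ with transmission probability $T$, reflection probability $R$ and Bogoliubov coefficients $\alpha,\beta$ as defined in the context. Let $\varphi\in C^2(\mathbb{R})$ and $\chi\in C^1(\mathbb{R})$ be real-valued with $\varphi'(x)>0$ for all $x$, $\varphi'(x)\to k_{\pm\infty}$ and $\chi(x)\to0$ as $x\to\pm\infty$. Put $$\vartheta(x)=\frac{\sqrt{[\varphi''+2\chi\varphi']^2+\left[k^2+\chi^2+\chi'-(\varphi')^2\right]^2}}{2\varphi'} .$$ Then $$|\alpha|\le\cosh\left\{\int_{-\infty}^{+\infty}\vartheta\,dx\right\},\qquad |\beta|\le\sinh\left\{\int_{-\infty}^{+\infty}\vartheta\,dx\right\},$$ $$T\ge\mathrm{sech}^2\left\{\int_{-\infty}^{+\infty}\vartheta\,dx\right\},\qquad R\le\tanh^2\left\{\int_{-\infty}^{+\infty}\vartheta\,dx\right\}.$$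
   Context: Scattering conventions: $k^2(x)=2m[E-V(x)]/\hbar^2$ is a real continuous function on $\mathbb{R}$ (possibly negative somewhere) with $k^2(x)\to k_{\pm\infty}^2$ as $x\to\pm\infty$, $k_{\pm\infty}>0$, the convergence being fast enough that there is a solution of $\psi''+k^2\psi=0$ with $\psi(x)\sim e^{ik_{-\infty}x}/\sqrt{k_{-\infty}}$ as $x\to-\infty$ and $\psi(x)\sim\alpha\, e^{ik_{+\infty}x}/\sqrt{k_{+\infty}}+\beta\, e^{-ik_{+\infty}x}/\sqrt{k_{+\infty}}$ as $x\to+\infty$ (with the corresponding asymptotics for $\psi'$). The constants $\alpha,\beta$ are the Bogoliubov coefficients; they satisfy $|\alpha|^2-|\beta|^2=1$. The transmission and reflection probabilities are $T=1/|\alpha|^2$ and $R=|\beta|^2/|\alpha|^2$. If an integral diverges to $+\infty$ the bounds are read as trivial ($\mathrm{sech}^2\infty=0$, $\tanh^2\infty=1$). *)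

theory Defs
  imports "HOL-Analysis.Analysis"
begin

text \<open>The function \<open>k2\<close> plays the role of \<open>k\<^sup>2(x) = 2m[E - V(x)]/\<hbar>\<^sup>2\<close>; it may take negative values.\<close>

definition scattering_potential :: "(real \<Rightarrow> real) \<Rightarrow> real \<Rightarrow> real \<Rightarrow> bool" where
  "scattering_potential k2 km kp \<longleftrightarrow>
     continuous_on UNIV k2 \<and> 0 < km \<and> 0 < kp \<and>
     (k2 \<longlongrightarrow> km\<^sup>2) at_bot \<and> (k2 \<longlongrightarrow> kp\<^sup>2) at_top"

definition schroedinger_solution ::
    "(real \<Rightarrow> real) \<Rightarrow> (real \<Rightarrow> complex) \<Rightarrow> (real \<Rightarrow> complex) \<Rightarrow> bool" where
  "schroedinger_solution k2 \<psi> \<psi>' \<longleftrightarrow>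
     (\<forall>x. (\<psi> has_vector_derivative \<psi>' x) (at x) \<and>
          (\<exists>\<psi>''. (\<psi>' has_vector_derivative \<psi>'') (at x) \<and> \<psi>'' + of_real (k2 x) * \<psi> x = 0))"

definition right_wave :: "real \<Rightarrow> real \<Rightarrow> complex" where
  "right_wave k x = exp (\<i> * of_real (k * x)) / of_real (sqrt k)"

definition left_wave :: "real \<Rightarrow> real \<Rightarrow> complex" where
  "left_wave k x = exp (- \<i> * of_real (k * x)) / of_real (sqrt k)"

text \<open>
  The relation \<open>f \<sim> g\<close> between (sums of) plane waves is read as \<open>f - g \<longlongrightarrow> 0\<close>. The asymptotics of
  \<open>\<psi>'\<close> are those obtained by differentiating the plane waves.
\<close>

definition bogoliubov_coefficients ::
    "(real \<Rightarrow> real) \<Rightarrow> real \<Rightarrow> real \<Rightarrow> complex \<Rightarrow> complex \<Rightarrow> bool" where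
  "bogoliubov_coefficients k2 km kp \<alpha> \<beta> \<longleftrightarrow>
     (\<exists>\<psi> \<psi>'. schroedinger_solution k2 \<psi> \<psi>' \<and>
        ((\<lambda>x. \<psi> x - right_wave km x) \<longlongrightarrow> 0) at_bot \<and>
        ((\<lambda>x. \<psi>' x - \<i> * of_real km * right_wave km x) \<longlongrightarrow> 0) at_bot \<and>
        ((\<lambda>x. \<psi> x - (\<alpha> * right_wave kp x + \<beta> * left_wave kp x)) \<longlongrightarrow> 0) at_top \<and>
        ((\<lambda>x. \<psi>' x - \<i> * of_real kp * (\<alpha> * right_wave kp x - \<beta> * left_wave kp x)) \<longlongrightarrow> 0) at_top)"

definition transmission_prob :: "complex \<Rightarrow> real" where
  "transmission_prob \<alpha> = 1 / (norm \<alpha>)\<^sup>2"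

definition reflection_prob :: "complex \<Rightarrow> complex \<Rightarrow> real" where
  "reflection_prob \<alpha> \<beta> = (norm \<beta>)\<^sup>2 / (norm \<alpha>)\<^sup>2"

definition vartheta ::
    "(real \<Rightarrow> real) \<Rightarrow> (real \<Rightarrow> real) \<Rightarrow> (real \<Rightarrow> real) \<Rightarrow> real \<Rightarrow> real" where
  "vartheta k2 \<phi> chi x =
     sqrt ((deriv (deriv \<phi>) x + 2 * chi x * deriv \<phi> x)\<^sup>2
           + (k2 x + (chi x)\<^sup>2 + deriv chi x - (deriv \<phi> x)\<^sup>2)\<^sup>2)
     / (2 * deriv \<phi> x)"

text \<open>
  The integral of the nonnegative function \<open>vartheta\<close> may diverge, so it is taken with values in
  \<open>[0, \<infinity>]\<close> and the hyperbolic functions are extended to \<open>\<infinity>\<close> by their limits.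
\<close>

definition vartheta_integral ::
    "(real \<Rightarrow> real) \<Rightarrow> (real \<Rightarrow> real) \<Rightarrow> (real \<Rightarrow> real) \<Rightarrow> ennreal" where
  "vartheta_integral k2 \<phi> chi = (\<integral>\<^sup>+ x. ennreal (vartheta k2 \<phi> chi x) \<partial>lborel)"

definition cosh_ext :: "ennreal \<Rightarrow> ennreal" where
  "cosh_ext I = (if I = \<infinity> then \<infinity> else ennreal (cosh (enn2real I)))"

definition sinh_ext :: "ennreal \<Rightarrow> ennreal" where
  "sinh_ext I = (if I = \<infinity> then \<infinity> else ennreal (sinh (enn2real I)))"

definition sech2_ext :: "ennreal \<Rightarrow> real" where
  "sech2_ext I = (if I = \<infinity> then 0 else (1 / cosh (enn2real I))\<^sup>2)"

definition tanh2_ext :: "ennreal \<Rightarrow> real" where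
  "tanh2_ext I = (if I = \<infinity> then 1 else (tanh (enn2real I))\<^sup>2)"

end

theory Submission
  imports Defs
begin

text \<open>
  Put \<open>p = \<phi>'\<close>, \<open>w = \<psi>' - \<chi> \<psi>\<close> and \<open>N = (|w|\<^sup>2 / p + p |\<psi>|\<^sup>2) / 2\<close>. With
  \<open>X = (|w|\<^sup>2 / p - p |\<psi>|\<^sup>2) / 2\<close> and \<open>Y = Re (cnj \<psi> w)\<close> one finds
  \<open>N' = - (\<phi>'' + 2 \<chi> \<phi>') / p * X - (k\<^sup>2 + \<chi>\<^sup>2 + \<chi>' - p\<^sup>2) / p * Y\<close>, while
  \<open>N\<^sup>2 - X\<^sup>2 - Y\<^sup>2\<close> is the square of the conserved current \<open>Im (cnj \<psi> w) = 1\<close>. By Cauchy-Schwarz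
  \<open>N' \<le> 2 \<vartheta> sqrt (N\<^sup>2 - 1)\<close>, so \<open>arcosh N\<close> increases by at most \<open>2 \<integral> \<vartheta>\<close>. Finally \<open>N\<close>
  tends to \<open>1\<close> at \<open>-\<infinity>\<close> and to \<open>|\<alpha>|\<^sup>2 + |\<beta>|\<^sup>2 = 2 |\<alpha>|\<^sup>2 - 1\<close> at \<open>+\<infinity>\<close>, and the
  bound on \<open>|\<alpha>|\<close> is the half-argument formula for \<open>cosh\<close>.
\<close>

section \<open>Energy, imbalance and conserved current\<close>

definition wave_energy :: "real \<Rightarrow> complex \<Rightarrow> complex \<Rightarrow> real" where
  "wave_energy p u w = ((norm w)\<^sup>2 / p + p * (norm u)\<^sup>2) / 2"

text \<open>For \<open>u = A + B\<close> and \<open>w = \<i> * p * (A - B)\<close>, with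
  \<open>A\<close> and \<open>B\<close> the right- and left-moving parts, \<open>wave_energy\<close>
  is \<open>p * (|A|^2 + |B|^2)\<close>, while the imbalance and \<open>Re (cnj u * w)\<close> are
  the real and imaginary parts of \<open>-2 * p * A * cnj B\<close>, the interference term.\<close>

definition wave_imbalance :: "real \<Rightarrow> complex \<Rightarrow> complex \<Rightarrow> real" where
  "wave_imbalance p u w = ((norm w)\<^sup>2 / p - p * (norm u)\<^sup>2) / 2"

lemma wave_energy_identity:
  assumes "p \<noteq> 0"
  shows "(wave_imbalance p u w)\<^sup>2 + (Re (cnj u * w))\<^sup>2 = (wave_energy p u w)\<^sup>2 - (Im (cnj u * w))\<^sup>2"
proof -
  have "(wave_energy p u w)\<^sup>2 - (wave_imbalance p u w)\<^sup>2 = (norm w)\<^sup>2 * (norm u)\<^sup>2"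
    using assms unfolding wave_energy_def wave_imbalance_def by (simp add: field_simps power2_eq_square)
  also have "\<dots> = (norm (cnj u * w))\<^sup>2"
    by (simp add: norm_mult power_mult_distrib)
  also have "\<dots> = (Re (cnj u * w))\<^sup>2 + (Im (cnj u * w))\<^sup>2"
    by (rule cmod_power2)
  finally show ?thesis by linarith
qed

text \<open>The hypotheses on \<open>u\<close> and \<open>w\<close> are the Schroedinger equation as
  a first-order system for \<open>w = u' - c * u\<close>. Any derivative of \<open>c\<close> is
  absorbed into \<open>K\<close>, so only the value of \<open>c\<close> at \<open>x\<close>
  enters.\<close>

lemma wave_energy_has_derivative:
  fixes u w :: "real \<Rightarrow> complex" and p :: "real \<Rightarrow> real"
  assumes u: "(u has_vector_derivative (w x + of_real c * u x)) (at x)"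
    and w: "(w has_vector_derivative (- of_real K * u x - of_real c * w x)) (at x)"
    and p: "(p has_real_derivative p') (at x)" and "p x \<noteq> 0"
  shows "((\<lambda>x. wave_energy (p x) (u x) (w x)) has_real_derivative
           - (p' + 2 * c * p x) / p x * wave_imbalance (p x) (u x) (w x)
           - (K - (p x)\<^sup>2) / p x * Re (cnj (u x) * w x)) (at x)"
proof -
  have two: "(2::real) \<noteq> 0" by simp
  show ?thesis
    unfolding wave_energy_def wave_imbalance_def cmod_power2
    by (rule derivative_eq_intros u w p refl \<open>p x \<noteq> 0\<close> two)+
      (use \<open>p x \<noteq> 0\<close> in \<open>simp add: field_simps power2_eq_square\<close>)
qed

text \<open>As \<open>c\<close> is real, \<open>Im (cnj u * w) = Im (cnj u * u')\<close>, the
  Wronskian of \<open>u\<close> and its conjugate up to a factor. The \<open>c\<close> terms cancel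
  in its derivative, and the rest is real because \<open>K\<close> is.\<close>

lemma wave_current_has_derivative:
  fixes u w :: "real \<Rightarrow> complex"
  assumes u: "(u has_vector_derivative (w x + of_real c * u x)) (at x)"
    and w: "(w has_vector_derivative (- of_real K * u x - of_real c * w x)) (at x)"
  shows "((\<lambda>x. Im (cnj (u x) * w x)) has_real_derivative 0) (at x)"
  unfolding times_complex.sel cnj.sel
  by (rule derivative_eq_intros u w refl)+ (simp add: algebra_simps)

section \<open>Asymptotics of energy and current\<close>

text \<open>Plane waves oscillate without a limit, so asymptotics are kept as differences tending to
  0. Boundedness of \<open>A\<close> and \<open>B\<close> controls the cross terms of the expanded
  product.\<close>

lemma tendsto_diff_mult_bounded:
  fixes a b :: "'a \<Rightarrow> 'b::real_normed_field"
  assumes a: "((\<lambda>x. a x - A x) \<longlongrightarrow> 0) F" and b: "((\<lambda>x. b x - B x) \<longlongrightarrow> 0) F"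
    and A: "\<And>x. norm (A x) \<le> M" and B: "\<And>x. norm (B x) \<le> M'"
  shows "((\<lambda>x. a x * b x - A x * B x) \<longlongrightarrow> 0) F"
proof -
  have "((\<lambda>x. (a x - A x) * (b x - B x) + (a x - A x) * B x + A x * (b x - B x)) \<longlongrightarrow> 0 * 0 + 0 + 0) F"
    by (intro tendsto_add tendsto_mult a b lim_null_mult_right_bounded[OF a, where B = M']
        lim_null_mult_left_bounded[OF _ b, where B = M] always_eventually allI A B)
  then show ?thesis by (simp add: algebra_simps)
qed

lemma tendsto_diff_norm_square:
  fixes z Z :: "'a \<Rightarrow> complex"
  assumes z: "((\<lambda>x. z x - Z x) \<longlongrightarrow> 0) F" and Z: "\<And>x. norm (Z x) \<le> M"
  shows "((\<lambda>x. (norm (z x))\<^sup>2 - (norm (Z x))\<^sup>2) \<longlongrightarrow> 0) F"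
proof -
  have "((\<lambda>x. norm (z x) - norm (Z x)) \<longlongrightarrow> 0) F"
    by (rule Lim_null_comparison[OF always_eventually tendsto_norm_zero[OF z]])
       (simp add: norm_triangle_ineq3)
  from tendsto_diff_mult_bounded[OF this this, of M M] Z show ?thesis
    by (simp add: power2_eq_square)
qed

text \<open>The profile of \<open>w\<close> is written with its own amplitude \<open>V\<close>,
  since differentiation flips the sign of the left-moving part of \<open>U\<close>.\<close>

lemma wave_asymptotics:
  fixes u w U V :: "real \<Rightarrow> complex"
  assumes p: "(p \<longlongrightarrow> k) F" and k: "0 < k"
    and u: "((\<lambda>x. u x - U x) \<longlongrightarrow> 0) F"
    and w: "((\<lambda>x. w x - \<i> * of_real k * V x) \<longlongrightarrow> 0) F"
    and U: "\<And>x. norm (U x) \<le> M" and V: "\<And>x. norm (V x) \<le> M"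
  shows "((\<lambda>x. wave_energy (p x) (u x) (w x) - k * ((norm (V x))\<^sup>2 + (norm (U x))\<^sup>2) / 2) \<longlongrightarrow> 0) F"
    and "((\<lambda>x. Im (cnj (u x) * w x) - k * Re (cnj (U x) * V x)) \<longlongrightarrow> 0) F"
proof -
  have W: "norm (\<i> * of_real k * V x) \<le> k * M" for x
    using V[of x] k by (simp add: norm_mult)
  have U2: "norm ((norm (U x))\<^sup>2) \<le> M\<^sup>2" for x
    using U[of x] by (simp add: power_mono)
  have W2: "norm ((norm (\<i> * of_real k * V x))\<^sup>2) \<le> (k * M)\<^sup>2" for x
    using W[of x] by (simp add: power_mono)
  have p0: "((\<lambda>x. p x - k) \<longlongrightarrow> 0) F" "((\<lambda>x. inverse (p x) - inverse k) \<longlongrightarrow> 0) F"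
    using p k by (auto simp: LIM_zero_iff intro!: tendsto_inverse)
  have 1: "((\<lambda>x. inverse (p x) * (norm (w x))\<^sup>2 - inverse k * (norm (\<i> * of_real k * V x))\<^sup>2) \<longlongrightarrow> 0) F"
    by (rule tendsto_diff_mult_bounded[OF p0(2) tendsto_diff_norm_square[OF w W] order_refl W2])
  have 2: "((\<lambda>x. p x * (norm (u x))\<^sup>2 - k * (norm (U x))\<^sup>2) \<longlongrightarrow> 0) F"
    by (rule tendsto_diff_mult_bounded[OF p0(1) tendsto_diff_norm_square[OF u U] order_refl U2])
  have "((\<lambda>x. ((inverse (p x) * (norm (w x))\<^sup>2 - inverse k * (norm (\<i> * of_real k * V x))\<^sup>2)
            + (p x * (norm (u x))\<^sup>2 - k * (norm (U x))\<^sup>2)) / 2) \<longlongrightarrow> (0 + 0) / 2) F"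
    by (intro tendsto_intros 1 2) simp
  moreover have "((inverse (p x) * (norm (w x))\<^sup>2 - inverse k * (norm (\<i> * of_real k * V x))\<^sup>2)
            + (p x * (norm (u x))\<^sup>2 - k * (norm (U x))\<^sup>2)) / 2
      = wave_energy (p x) (u x) (w x) - k * ((norm (V x))\<^sup>2 + (norm (U x))\<^sup>2) / 2" for x
    using k by (simp add: wave_energy_def norm_mult field_simps power2_eq_square)
  ultimately show "((\<lambda>x. wave_energy (p x) (u x) (w x)
      - k * ((norm (V x))\<^sup>2 + (norm (U x))\<^sup>2) / 2) \<longlongrightarrow> 0) F"
    by simp
  have cu: "((\<lambda>x. cnj (u x) - cnj (U x)) \<longlongrightarrow> 0) F"
    using tendsto_cnj[OF u] by simp
  have cU: "norm (cnj (U x)) \<le> M" for x using U by simp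
  from tendsto_Im[OF tendsto_diff_mult_bounded[OF cu w cU W]]
  show "((\<lambda>x. Im (cnj (u x) * w x) - k * Re (cnj (U x) * V x)) \<longlongrightarrow> 0) F"
    by (simp add: algebra_simps)
qed

lemma norm_right_wave: "0 < k \<Longrightarrow> norm (right_wave k x) = 1 / sqrt k"
  by (simp add: right_wave_def norm_divide)

lemma cnj_right_wave: "cnj (right_wave k x) = left_wave k x"
  by (simp add: right_wave_def left_wave_def exp_cnj)

lemma norm_left_wave: "0 < k \<Longrightarrow> norm (left_wave k x) = 1 / sqrt k"
  by (metis cnj_right_wave complex_mod_cnj norm_right_wave)

text \<open>Parallelogram law; it removes the interference of the two waves from the limiting
  energy.\<close>

lemma norm_mix_square_sum:
  "(norm (a - b))\<^sup>2 + (norm (a + b))\<^sup>2 = 2 * ((norm a)\<^sup>2 + (norm b)\<^sup>2)" for a b :: complex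
  unfolding cmod_power2 by (simp add: power2_eq_square algebra_simps)

text \<open>The cross terms \<open>cnj b * a - cnj a * b\<close> are purely imaginary, so no
  interference survives in the current.\<close>

lemma Re_cnj_mix: "Re (cnj (a + b) * (a - b)) = (norm a)\<^sup>2 - (norm b)\<^sup>2"
  unfolding cmod_power2 by (simp add: power2_eq_square algebra_simps)

section \<open>Growth of the energy\<close>

text \<open>Links the integral of the fundamental theorem of calculus to the extended Lebesgue
  integral. Finiteness matters because \<open>enn2real\<close> sends infinity to 0.\<close>

lemma interval_integral_le_nn_integral:
  fixes f :: "real \<Rightarrow> real"
  assumes f: "continuous_on UNIV f" "\<And>x. 0 \<le> f x"
    and I: "(\<integral>\<^sup>+ x. ennreal (f x) \<partial>lborel) \<noteq> \<infinity>"
  shows "integral {a..b} f \<le> enn2real (\<integral>\<^sup>+ x. ennreal (f x) \<partial>lborel)"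
proof -
  have "(f has_integral integral {a..b} f) {a..b}"
    by (intro integrable_integral integrable_continuous_real continuous_on_subset[OF f(1)]) simp
  then have "ennreal (integral {a..b} f) = (\<integral>\<^sup>+ x. ennreal (f x) * indicator {a..b} x \<partial>lborel)"
    using f(2) by (intro nn_integral_has_integral_lebesgue'[symmetric])
  also have "\<dots> \<le> (\<integral>\<^sup>+ x. ennreal (f x) \<partial>lborel)"
    by (intro nn_integral_mono) (auto simp: indicator_def)
  finally show ?thesis
    using I f(2) by (metis enn2real_ennreal enn2real_mono ennreal_neq_top infinity_ennreal_def
        integral_nonneg not_integrable_integral order_refl top.not_eq_extremum)
qed

text \<open>\<open>arcosh\<close> is not differentiable at \<open>1\<close>, where the energy starts, hence the shift by \<open>e\<close>.\<close>
lemma cosh_growth_bound: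
  fixes N g :: "real \<Rightarrow> real"
  assumes N: "\<And>x. (N has_real_derivative N' x) (at x)" "\<And>x. 1 \<le> N x"
    and N': "\<And>x. N' x \<le> g x * sqrt ((N x)\<^sup>2 - 1)"
    and g: "continuous_on UNIV g" "\<And>x. 0 \<le> g x"
    and "a \<le> b" "0 < e"
  shows "N b + e \<le> cosh (arcosh (N a + e) + integral {a..b} g)"
proof -
  let ?A = "\<lambda>x. arcosh (N x + e)"
  let ?A' = "\<lambda>x. N' x / sqrt ((N x + e)\<^sup>2 - 1)"
  have gt1: "1 < N x + e" for x using N(2)[of x] \<open>0 < e\<close> by linarith
  have A: "(?A has_real_derivative ?A' x) (at x)" for x
    using DERIV_chain2[OF arcosh_real_has_field_derivative[OF gt1] DERIV_add[OF N(1) DERIV_const]] by simp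
  have A'_le: "?A' x \<le> g x" for x
  proof -
    \<comment> \<open>Enlarging the root before dividing is sound since \<open>g\<close> is
      nonnegative, even where \<open>N'\<close> is negative.\<close>
    have "sqrt ((N x)\<^sup>2 - 1) \<le> sqrt ((N x + e)\<^sup>2 - 1)"
      using N(2)[of x] \<open>0 < e\<close> by (intro real_sqrt_le_mono diff_right_mono power_mono) auto
    then have "N' x \<le> g x * sqrt ((N x + e)\<^sup>2 - 1)"
      using N'[of x] g(2)[of x] by (meson mult_left_mono order_trans)
    moreover have "0 < sqrt ((N x + e)\<^sup>2 - 1)" using gt1[of x] by simp
    ultimately show ?thesis by (simp add: pos_divide_le_eq)
  qed
  have "(?A' has_integral ?A b - ?A a) {a..b}"
    using A \<open>a \<le> b\<close>
    by (intro fundamental_theorem_of_calculus)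
       (auto simp: has_real_derivative_iff_has_vector_derivative[symmetric] has_field_derivative_at_within)
  moreover have "(g has_integral integral {a..b} g) {a..b}"
    by (intro integrable_integral integrable_continuous_real continuous_on_subset[OF g(1)]) simp
  ultimately have "?A b - ?A a \<le> integral {a..b} g"
    by (rule has_integral_le) (rule A'_le)
  \<comment> \<open>Monotonicity of \<open>cosh\<close> needs nonnegative arguments; the right one
    dominates \<open>?A b\<close>, which is nonnegative.\<close>
  then have "cosh (?A b) \<le> cosh (?A a + integral {a..b} g)"
    using gt1[of b] by (subst cosh_real_nonneg_le_iff)
      (auto intro: order_trans[OF arcosh_nonneg_real[of "N b + e"]])
  then show ?thesis using gt1[of b] by simp
qed

text \<open>The limits are taken in the order \<open>a\<close> to minus infinity, \<open>e\<close>
  to 0, \<open>b\<close> to plus infinity: a positive \<open>e\<close> keeps \<open>arcosh\<close>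
  continuous at the limit \<open>1 + e\<close> of \<open>N a + e\<close>. The result then follows
  from \<open>arcosh 1 = 0\<close>.\<close>

lemma cosh_growth_limit:
  fixes N g :: "real \<Rightarrow> real"
  assumes N: "\<And>x. (N has_real_derivative N' x) (at x)" "\<And>x. 1 \<le> N x"
    and N': "\<And>x. N' x \<le> g x * sqrt ((N x)\<^sup>2 - 1)"
    and g: "continuous_on UNIV g" "\<And>x. 0 \<le> g x"
    and J: "\<And>a b. integral {a..b} g \<le> J"
    and bot: "(N \<longlongrightarrow> 1) at_bot" and top: "(N \<longlongrightarrow> L) at_top"
  shows "L \<le> cosh J"
proof -
  have J0: "0 \<le> J" using J[of 0 0] by simp
  have cont: "isCont (arcosh :: real \<Rightarrow> real) (1 + e)" if "0 < e" for e
    using that by (intro DERIV_isCont[OF arcosh_real_has_field_derivative]) simp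
  have ab: "N b + e \<le> cosh (arcosh (N a + e) + J)" if "a \<le> b" "0 < e" for a b e
  proof -
    have "0 \<le> arcosh (N a + e)" "0 \<le> integral {a..b} g"
      using N(2)[of a] that g(2) by (auto intro!: integral_nonneg integrable_continuous_real
          continuous_on_subset[OF g(1)] arcosh_nonneg_real)
    then have "cosh (arcosh (N a + e) + integral {a..b} g) \<le> cosh (arcosh (N a + e) + J)"
      using J[of a b] J0 by (subst cosh_real_nonneg_le_iff) auto
    with cosh_growth_bound[OF N N' g that] show ?thesis by linarith
  qed
  have e: "N b + e \<le> cosh (arcosh (1 + e) + J)" if "0 < e" for b e
  proof (rule tendsto_lowerbound)
    show "((\<lambda>a. cosh (arcosh (N a + e) + J)) \<longlongrightarrow> cosh (arcosh (1 + e) + J)) at_bot"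
      by (intro tendsto_intros isCont_tendsto_compose[OF cont[OF that]] bot)
    show "\<forall>\<^sub>F a in at_bot. N b + e \<le> cosh (arcosh (N a + e) + J)"
      using eventually_le_at_bot[of b] by eventually_elim (rule ab[OF _ that])
  qed simp
  have "N b \<le> cosh (arcosh 1 + J)" for b
  proof (rule tendsto_le)
    show "((\<lambda>e. N b + e) \<longlongrightarrow> N b) (at_right 0)"
      by (auto intro!: tendsto_eq_intros)
    \<comment> \<open>At 1 only continuity of \<open>arcosh\<close> from the right is available,
      hence the limit within a half-line.\<close>
    have "continuous_on {0::real..} (\<lambda>e. arcosh (1 + e))"
      by (intro continuous_intros) auto
    then have "((\<lambda>e. arcosh (1 + e :: real)) \<longlongrightarrow> arcosh (1 + 0)) (at 0 within {0..})"
      unfolding continuous_on_def by (metis atLeast_iff order_refl)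
    then have "((\<lambda>e. arcosh (1 + e :: real)) \<longlongrightarrow> arcosh 1) (at_right 0)"
      unfolding add_0_right by (rule tendsto_within_subset) auto
    then show "((\<lambda>e. cosh (arcosh (1 + e) + J)) \<longlongrightarrow> cosh (arcosh 1 + J)) (at_right 0)"
      by (intro tendsto_cosh tendsto_add tendsto_const)
    show "\<forall>\<^sub>F e in at_right 0. N b + e \<le> cosh (arcosh (1 + e) + J)"
      using eventually_at_right_less by eventually_elim (rule e)
  qed simp
  then show ?thesis
    by (intro tendsto_upperbound[OF top]) auto
qed

text \<open>Uniqueness of derivatives identifies the continuous derivative supplied by the
  hypothesis with \<open>deriv\<close>, which \<open>vartheta\<close> uses.\<close>

lemma C1_differentiable_on_UNIV_deriv:
  fixes f :: "real \<Rightarrow> real"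
  assumes "f C1_differentiable_on UNIV"
  shows "(f has_real_derivative deriv f x) (at x)" and "continuous_on UNIV (deriv f)"
proof -
  obtain D where D: "\<And>x. (f has_real_derivative D x) (at x)" "continuous_on UNIV D"
    using assms by (auto simp: C1_differentiable_on_def has_real_derivative_iff_has_vector_derivative)
  then have "deriv f = D" by (auto intro: DERIV_imp_deriv)
  with D show "(f has_real_derivative deriv f x) (at x)" "continuous_on UNIV (deriv f)" by auto
qed

section \<open>The scattering solution\<close>

text \<open>The normalisation of the coefficients is derived by comparing the conserved current at
  both ends. Both claims share the same asymptotics, and all four final bounds follow from
  them.\<close>

lemma bogoliubov_current_and_bound:
  fixes k2 \<phi> chi :: "real \<Rightarrow> real" and km kp :: real and \<alpha> \<beta> :: complex
  assumes pot: "scattering_potential k2 km kp"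
    and bog: "bogoliubov_coefficients k2 km kp \<alpha> \<beta>"
    and C2: "\<phi> C1_differentiable_on UNIV" "deriv \<phi> C1_differentiable_on UNIV"
    and C1: "chi C1_differentiable_on UNIV"
    and pos: "\<And>x. deriv \<phi> x > 0"
    and p_lim: "(deriv \<phi> \<longlongrightarrow> km) at_bot" "(deriv \<phi> \<longlongrightarrow> kp) at_top"
    and chi_lim: "(chi \<longlongrightarrow> 0) at_bot" "(chi \<longlongrightarrow> 0) at_top"
  shows "(norm \<alpha>)\<^sup>2 - (norm \<beta>)\<^sup>2 = 1"
    and "vartheta_integral k2 \<phi> chi \<noteq> \<infinity> \<Longrightarrow>
           norm \<alpha> \<le> cosh (enn2real (vartheta_integral k2 \<phi> chi))"
proof -
  define p where "p = deriv \<phi>"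
  define K where "K = (\<lambda>x. k2 x + (chi x)\<^sup>2 + deriv chi x)"
  obtain \<psi> \<psi>' where sol: "schroedinger_solution k2 \<psi> \<psi>'"
    and m0: "((\<lambda>x. \<psi> x - right_wave km x) \<longlongrightarrow> 0) at_bot"
    and m1: "((\<lambda>x. \<psi>' x - \<i> * of_real km * right_wave km x) \<longlongrightarrow> 0) at_bot"
    and p0: "((\<lambda>x. \<psi> x - (\<alpha> * right_wave kp x + \<beta> * left_wave kp x)) \<longlongrightarrow> 0) at_top"
    and p1: "((\<lambda>x. \<psi>' x - \<i> * of_real kp * (\<alpha> * right_wave kp x - \<beta> * left_wave kp x)) \<longlongrightarrow> 0) at_top"
    using bog unfolding bogoliubov_coefficients_def by blast
  define w where "w = (\<lambda>x. \<psi>' x - of_real (chi x) * \<psi> x)"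
  have km: "0 < km" and kp: "0 < kp" and k2: "continuous_on UNIV k2"
    using pot by (auto simp: scattering_potential_def)
  note dchi = C1_differentiable_on_UNIV_deriv[OF C1]
  note dp = C1_differentiable_on_UNIV_deriv[OF C2(2), folded p_def]
  have p_pos: "0 < p x" for x using pos by (simp add: p_def)

  have du: "(\<psi> has_vector_derivative (w x + of_real (chi x) * \<psi> x)) (at x)" for x
    using sol by (simp add: schroedinger_solution_def w_def)
  \<comment> \<open>Substituting \<open>\<psi>' = w + chi * \<psi>\<close> into the derivative of
    \<open>w\<close> collects \<open>k2\<close>, \<open>chi^2\<close> and \<open>chi'\<close> in
    \<open>K\<close>.\<close>
  have dw: "(w has_vector_derivative (- of_real (K x) * \<psi> x - of_real (chi x) * w x)) (at x)" for x
  proof -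
    obtain \<psi>'' where \<psi>'': "(\<psi>' has_vector_derivative \<psi>'') (at x)" "\<psi>'' = - of_real (k2 x) * \<psi> x"
      using sol unfolding schroedinger_solution_def by (metis add_eq_0_iff2 mult_minus_left)
    have c: "((\<lambda>x. complex_of_real (chi x)) has_vector_derivative of_real (deriv chi x)) (at x)"
      by (rule has_vector_derivative_of_real) (rule dchi(1))
    have "(w has_vector_derivative (\<psi>'' - (of_real (chi x) * (w x + of_real (chi x) * \<psi> x)
        + of_real (deriv chi x) * \<psi> x))) (at x)"
      unfolding w_def using du[of x, unfolded w_def]
      by (intro has_vector_derivative_diff has_vector_derivative_mult \<psi>'' c)
    then show ?thesis
      by (simp add: \<psi>'' K_def algebra_simps power2_eq_square)
  qed

  define N where "N = (\<lambda>x. wave_energy (p x) (\<psi> x) (w x))"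
  define X where "X = (\<lambda>x. wave_imbalance (p x) (\<psi> x) (w x))"
  define Y where "Y = (\<lambda>x. Re (cnj (\<psi> x) * w x))"
  define J where "J = (\<lambda>x. Im (cnj (\<psi> x) * w x))"
  define N' where "N' = (\<lambda>x. - (deriv p x + 2 * chi x * p x) / p x * X x - (K x - (p x)\<^sup>2) / p x * Y x)"
  have dN: "(N has_real_derivative N' x) (at x)" for x
    unfolding N_def N'_def X_def Y_def
    by (rule wave_energy_has_derivative[OF du dw dp(1)]) (use p_pos[of x] in simp)
  have "(J has_real_derivative 0) (at x)" for x
    unfolding J_def by (rule wave_current_has_derivative[OF du dw])
  then have J_const: "J x = J 0" for x
    by (intro DERIV_isconst_all) auto

  \<comment> \<open>Since \<open>chi\<close> tends to 0 and \<open>\<psi>\<close> is close to a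
    bounded profile, \<open>w\<close> and \<open>\<psi>'\<close> have the same asymptotics.\<close>
  have w_lim: "((\<lambda>x. w x - W x) \<longlongrightarrow> 0) F"
    if "((\<lambda>x. \<psi>' x - W x) \<longlongrightarrow> 0) F" "((\<lambda>x. \<psi> x - U x) \<longlongrightarrow> 0) F" "(chi \<longlongrightarrow> 0) F"
       "\<And>x. norm (U x) \<le> M" for W U :: "real \<Rightarrow> complex" and F M
  proof -
    have "((\<lambda>x. of_real (chi x) - (0::complex)) \<longlongrightarrow> 0) F"
      using tendsto_of_real[OF that(3), where 'a = complex] by simp
    from tendsto_diff_mult_bounded[OF this that(2), of 0 M] that(4)
    have "((\<lambda>x. of_real (chi x) * \<psi> x) \<longlongrightarrow> 0) F" by simp
    from tendsto_diff[OF that(1) this] show ?thesis by (simp add: w_def algebra_simps)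
  qed

  have rm: "norm (right_wave km x) \<le> 1 / sqrt km" for x
    using km by (simp add: norm_right_wave)
  \<comment> \<open>On the left there is only a right-moving wave, so both amplitudes
    \<open>U\<close> and \<open>V\<close> are \<open>right_wave km\<close>.\<close>
  note asym_m = wave_asymptotics[OF p_lim(1)[folded p_def] km m0 w_lim[OF m1 m0 chi_lim(1) rm] rm rm]
  have N_bot: "(N \<longlongrightarrow> 1) at_bot"
    using asym_m(1) km
    by (simp add: norm_right_wave power_divide LIM_zero_iff N_def)
  have "Re (cnj (right_wave km x) * right_wave km x) = 1 / km" for x
    using Re_cnj_mix[of "right_wave km x" 0] km by (simp add: norm_right_wave power_divide)
  then have J_bot: "(J \<longlongrightarrow> 1) at_bot"
    using asym_m(2) km by (simp add: LIM_zero_iff J_def del: times_complex.sel)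
  have J1: "J x = 1" for x
  proof -
    have "J = (\<lambda>_. J 0)" using J_const by blast
    then have "J 0 = 1" using J_bot
      by (metis tendsto_const tendsto_unique trivial_limit_at_bot_linorder)
    then show ?thesis using J_const by simp
  qed

  let ?U = "\<lambda>x. \<alpha> * right_wave kp x + \<beta> * left_wave kp x"
  let ?V = "\<lambda>x. \<alpha> * right_wave kp x - \<beta> * left_wave kp x"
  let ?M = "norm \<alpha> / sqrt kp + norm \<beta> / sqrt kp"
  have na: "norm (\<alpha> * right_wave kp x) = norm \<alpha> / sqrt kp"
    and nb: "norm (\<beta> * left_wave kp x) = norm \<beta> / sqrt kp" for x
    using kp by (simp_all add: norm_mult norm_right_wave norm_left_wave)
  have U: "norm (?U x) \<le> ?M" and V: "norm (?V x) \<le> ?M" for x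
    using norm_triangle_ineq[of "\<alpha> * right_wave kp x" "\<beta> * left_wave kp x"]
      norm_triangle_ineq4[of "\<alpha> * right_wave kp x" "\<beta> * left_wave kp x"]
    unfolding na nb by auto
  note asym_p = wave_asymptotics[OF p_lim(2)[folded p_def] kp p0 w_lim[OF p1 p0 chi_lim(2) U] U V,
      unfolded norm_mix_square_sum Re_cnj_mix na nb]
  have N_top: "(N \<longlongrightarrow> (norm \<alpha>)\<^sup>2 + (norm \<beta>)\<^sup>2) at_top"
  proof -
    have "kp * (2 * ((norm \<alpha> / sqrt kp)\<^sup>2 + (norm \<beta> / sqrt kp)\<^sup>2)) / 2 = (norm \<alpha>)\<^sup>2 + (norm \<beta>)\<^sup>2"
      using kp by (simp add: power_divide field_simps)
    from LIM_zero_cancel[OF asym_p(1)[unfolded this]] show ?thesis by (simp add: N_def)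
  qed
  have J_top: "(J \<longlongrightarrow> (norm \<alpha>)\<^sup>2 - (norm \<beta>)\<^sup>2) at_top"
  proof -
    have "kp * ((norm \<alpha> / sqrt kp)\<^sup>2 - (norm \<beta> / sqrt kp)\<^sup>2) = (norm \<alpha>)\<^sup>2 - (norm \<beta>)\<^sup>2"
      using kp by (simp add: power_divide field_simps)
    from LIM_zero_cancel[OF asym_p(2)[unfolded this]] show ?thesis unfolding J_def .
  qed
  moreover have "J = (\<lambda>_. 1)" using J1 by blast
  ultimately show current: "(norm \<alpha>)\<^sup>2 - (norm \<beta>)\<^sup>2 = 1"
    by (metis tendsto_const tendsto_unique trivial_limit_at_top_linorder)

  let ?\<theta> = "vartheta k2 \<phi> chi"
  have \<theta>_eq: "?\<theta> x = sqrt ((deriv p x + 2 * chi x * p x)\<^sup>2 + (K x - (p x)\<^sup>2)\<^sup>2) / (2 * p x)" for x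
    by (simp add: vartheta_def p_def K_def)
  have \<theta>_nonneg: "0 \<le> ?\<theta> x" for x
    using p_pos[of x] by (simp add: \<theta>_eq)
  have p_cont: "continuous_on UNIV p" and chi_cont: "continuous_on UNIV chi"
    using dp(1) dchi(1) by (auto intro!: continuous_at_imp_continuous_on DERIV_isCont)
  have \<theta>_cont: "continuous_on UNIV ?\<theta>"
    unfolding \<theta>_eq K_def
    using p_pos by (intro continuous_intros p_cont chi_cont dp(2) dchi(2) k2)
      (metis less_irrefl mult_eq_0_iff zero_neq_numeral)

  have XY: "(X x)\<^sup>2 + (Y x)\<^sup>2 = (N x)\<^sup>2 - 1" for x
    using wave_energy_identity[of "p x" "\<psi> x" "w x"] p_pos[of x] J1[of x]
    by (simp add: X_def Y_def N_def J_def)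
  have N_ge: "1 \<le> N x" for x
  proof (rule power2_le_imp_le)
    show "1\<^sup>2 \<le> (N x)\<^sup>2" using XY[of x] sum_power2_ge_zero[of "X x" "Y x"] by simp
    show "0 \<le> N x" using p_pos[of x] by (simp add: N_def wave_energy_def)
  qed
  have N'_le: "N' x \<le> 2 * ?\<theta> x * sqrt ((N x)\<^sup>2 - 1)" for x
  proof -
    define a where "a = deriv p x + 2 * chi x * p x"
    define b where "b = K x - (p x)\<^sup>2"
    \<comment> \<open>Lagrange's identity; dropping the second square gives Cauchy-Schwarz.\<close>
    have "(a * X x + b * Y x)\<^sup>2 + (a * Y x - b * X x)\<^sup>2 = (a\<^sup>2 + b\<^sup>2) * ((X x)\<^sup>2 + (Y x)\<^sup>2)"
      by (simp add: power2_eq_square algebra_simps)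
    then have "(a * X x + b * Y x)\<^sup>2 \<le> (a\<^sup>2 + b\<^sup>2) * ((N x)\<^sup>2 - 1)"
      unfolding XY by (metis le_add_same_cancel1 zero_le_power2)
    then have "\<bar>a * X x + b * Y x\<bar> \<le> sqrt (a\<^sup>2 + b\<^sup>2) * sqrt ((N x)\<^sup>2 - 1)"
      by (metis real_sqrt_abs real_sqrt_le_mono real_sqrt_mult)
    then have "- (a * X x + b * Y x) / p x \<le> sqrt (a\<^sup>2 + b\<^sup>2) * sqrt ((N x)\<^sup>2 - 1) / p x"
      using p_pos[of x] by (intro divide_right_mono) auto
    moreover have "N' x = - (a * X x + b * Y x) / p x"
      unfolding N'_def a_def[symmetric] b_def[symmetric] by (simp add: diff_divide_distrib)
    ultimately show ?thesis
      unfolding \<theta>_eq a_def[symmetric] b_def[symmetric] by simp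
  qed

  show "norm \<alpha> \<le> cosh (enn2real (vartheta_integral k2 \<phi> chi))"
    if fin: "vartheta_integral k2 \<phi> chi \<noteq> \<infinity>"
  proof -
    define I where "I = enn2real (vartheta_integral k2 \<phi> chi)"
    \<comment> \<open>The growth rate is \<open>2 * ?\<theta>\<close> because
      \<open>sqrt (a^2 + b^2) / p\<close> is twice \<open>vartheta\<close>; the half-argument
      formula later removes the 2.\<close>
    have int: "integral {a..b} (\<lambda>x. 2 * ?\<theta> x) \<le> 2 * I" for a b
      using interval_integral_le_nn_integral[OF \<theta>_cont \<theta>_nonneg, of a b] fin
      by (simp add: I_def vartheta_integral_def)
    have "(norm \<alpha>)\<^sup>2 + (norm \<beta>)\<^sup>2 \<le> cosh (2 * I)"
      by (rule cosh_growth_limit[OF dN N_ge N'_le _ _ int N_bot N_top])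
         (use \<theta>_nonneg in \<open>auto intro!: continuous_intros \<theta>_cont\<close>)
    also have "\<dots> = 2 * (cosh I)\<^sup>2 - 1"
      by (simp add: cosh_double cosh_square_eq)
    finally have "(norm \<alpha>)\<^sup>2 \<le> (cosh I)\<^sup>2" using current by linarith
    then show ?thesis
      unfolding I_def[symmetric] by (rule power2_le_imp_le) simp
  qed
qed

section \<open>From the amplitude bound to the four estimates\<close>

theorem mainTheorem2:
  fixes k2 \<phi> chi :: "real \<Rightarrow> real" and km kp :: real and \<alpha> \<beta> :: complex
  assumes "scattering_potential k2 km kp"
    and "bogoliubov_coefficients k2 km kp \<alpha> \<beta>"
    and "\<phi> C1_differentiable_on UNIV" and "deriv \<phi> C1_differentiable_on UNIV"
    and "chi C1_differentiable_on UNIV"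
    and "\<And>x. deriv \<phi> x > 0"
    and "(deriv \<phi> \<longlongrightarrow> km) at_bot" and "(deriv \<phi> \<longlongrightarrow> kp) at_top"
    and "(chi \<longlongrightarrow> 0) at_bot" and "(chi \<longlongrightarrow> 0) at_top"
  shows "ennreal (norm \<alpha>) \<le> cosh_ext (vartheta_integral k2 \<phi> chi)
       \<and> ennreal (norm \<beta>) \<le> sinh_ext (vartheta_integral k2 \<phi> chi)
       \<and> transmission_prob \<alpha> \<ge> sech2_ext (vartheta_integral k2 \<phi> chi)
       \<and> reflection_prob \<alpha> \<beta> \<le> tanh2_ext (vartheta_integral k2 \<phi> chi)"
proof -
  have ab: "(norm \<beta>)\<^sup>2 = (norm \<alpha>)\<^sup>2 - 1"
    using bogoliubov_current_and_bound(1)[OF assms] by simp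
  \<comment> \<open>In particular \<open>\<alpha>\<close> is nonzero, so the quotients defining the
    probabilities are genuine.\<close>
  then have a_ge: "1 \<le> (norm \<alpha>)\<^sup>2" by (metis diff_ge_0_iff_ge zero_le_power2)
  \<comment> \<open>Reflection is one minus transmission, so its bound is that on transmission
    rewritten by \<open>tanh^2 = 1 - sech^2\<close>.\<close>
  have R: "reflection_prob \<alpha> \<beta> = 1 - 1 / (norm \<alpha>)\<^sup>2"
    using a_ge unfolding reflection_prob_def ab by (auto simp: diff_divide_distrib)
  show ?thesis
  proof (cases "vartheta_integral k2 \<phi> chi = \<infinity>")
    case True
    then show ?thesis
      by (simp add: cosh_ext_def sinh_ext_def sech2_ext_def tanh2_ext_def transmission_prob_def R)
  next
    case False
    define I where "I = enn2real (vartheta_integral k2 \<phi> chi)"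
    have I: "0 \<le> I" by (simp add: I_def)
    have a_le: "norm \<alpha> \<le> cosh I"
      using bogoliubov_current_and_bound(2)[OF assms False] by (simp add: I_def)
    then have a2_le: "(norm \<alpha>)\<^sup>2 \<le> (cosh I)\<^sup>2" by (simp add: power_mono)
    have "norm \<beta> \<le> sinh I"
    proof (rule power2_le_imp_le)
      show "(norm \<beta>)\<^sup>2 \<le> (sinh I)\<^sup>2" using a2_le ab by (simp add: cosh_square_eq)
    qed (use I in simp)
    moreover have T: "1 / (cosh I)\<^sup>2 \<le> 1 / (norm \<alpha>)\<^sup>2"
      using a2_le a_ge by (intro le_imp_inverse_le[unfolded inverse_eq_divide]) linarith+
    moreover have "(tanh I)\<^sup>2 = 1 - 1 / (cosh I)\<^sup>2"
      by (simp add: tanh_def power_divide sinh_square_eq diff_divide_distrib)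
    ultimately show ?thesis
      using False a_le
      by (simp add: cosh_ext_def sinh_ext_def sech2_ext_def tanh2_ext_def transmission_prob_def R
          power_divide ennreal_leI flip: I_def)
  qed
qed

end
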